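(* Let $\mathbb{A}$ be a unital $C^{\ast}$-algebra, let $(\mathcal{U},\mathbb{A},d)$ be a complete $C^{\ast}$-algebra-valued metric space, and let $T:\mathcal{U}\to\mathcal{U}$ be an interpolative Kannan type contraction, i.e. there exist $\tau,\beta\in(0,1)$ such that $$d(Tx,Ty)\preceq \tau\, d(x,Tx)^{\beta}\,d(y,Ty)^{1-\beta}$$ for all $x,y\in\mathcal{U}$ with $Tx\neq x$. Then $T$ has a fixed point in $\mathcal{U}$.
   Context: $\mathbb{A}$ is a unital $C^{\ast}$-algebra with unit $I$ and zero element $\theta$. Let $\mathbb{A}_h=\{x\in\mathbb{A}:x=x^{\ast}\}$. An element $x$ is positive, written $x\succeq\theta$, if $x\in\mathbb{A}_h$ and its spectrum satisfies $\sigma(x)\subset\mathbb{R}_+=[0,\infty)$; $\mathbb{A}_+$ is the set of positive elements. The relation $x\preceq y$ means $y-x\succeq\theta$. For $a\in\mathbb{A}_+$ and real $s>0$, $a^s\in\mathbb{A}_+$ is defined by the continuous functional calculus. A $C^{\ast}$-algebra-valued metric space $(\mathcal{U},\mathbb{A},d)$ is a non-empty set $\mathcal{U}$ with a map $d:\mathcal{U}\times\mathcal{U}\to\mathbb{A}_+$ such that (i) $d(x,y)=\theta$ if and only if $x=y$; (ii) $d(x,y)=d(y,x)$ for all $x,y$; (iii) $d(x,y)\preceq d(x,u)+d(u,y)$ for all $x,y,u$. A sequence $(x_n)$ converges to $z$ if $\|d(x_n,z)\|\to 0$; it is Cauchy if $\|d(x_n,x_m)\|\to 0$ as $n,m\to\infty$;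 the space is complete if every Cauchy sequence converges to a point of $\mathcal{U}$. *)

theory Defs
  imports "HOL-Analysis.Analysis"
begin

text \<open>Unital complex \<open>C\<^sup>*\<close>-algebras. The superclass \<open>real_normed_algebra_1\<close> includes
  \<open>1 \<noteq> 0\<close> and \<open>norm 1 = 1\<close>.\<close>

class cstar_algebra = real_normed_algebra_1 + banach +
  fixes scaleC :: "complex \<Rightarrow> 'a \<Rightarrow> 'a"  (infixr \<open>*\<^sub>C\<close> 75)
    and star :: "'a \<Rightarrow> 'a"
  assumes scaleC_add_right: "c *\<^sub>C (x + y) = c *\<^sub>C x + c *\<^sub>C y"
    and scaleC_add_left: "(c + c') *\<^sub>C x = c *\<^sub>C x + c' *\<^sub>C x"
    and scaleC_scaleC: "c *\<^sub>C (c' *\<^sub>C x) = (c * c') *\<^sub>C x"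
    and scaleC_of_real: "complex_of_real r *\<^sub>C x = r *\<^sub>R x"
    and mult_scaleC_left: "(c *\<^sub>C x) * y = c *\<^sub>C (x * y)"
    and mult_scaleC_right: "x * (c *\<^sub>C y) = c *\<^sub>C (x * y)"
    and norm_scaleC: "norm (c *\<^sub>C x) = cmod c * norm x"
    and star_add: "star (x + y) = star x + star y"
    and star_scaleC: "star (c *\<^sub>C x) = cnj c *\<^sub>C star x"
    and star_mult: "star (x * y) = star y * star x"
    and star_star: "star (star x) = x"
    and cstar_identity: "norm (star x * x) = (norm x)\<^sup>2"

definition spectrum :: "'a::cstar_algebra \<Rightarrow> complex set" where
  "spectrum a = {c. \<not> (\<exists>b. (a - c *\<^sub>C 1) * b = 1 \<and> b * (a - c *\<^sub>C 1) = 1)}"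

definition positive :: "'a::cstar_algebra \<Rightarrow> bool" where
  "positive a \<longleftrightarrow> star a = a \<and> spectrum a \<subseteq> complex_of_real ` {0..}"

definition cstar_le :: "'a::cstar_algebra \<Rightarrow> 'a \<Rightarrow> bool"  (infix \<open>\<preceq>\<close> 50) where
  "a \<preceq> b \<longleftrightarrow> positive (b - a)"

text \<open>\<open>\<Phi>\<close> is an isometric unital \<open>*\<close>-homomorphism from \<open>C(\<sigma>(a))\<close> (with the supremum norm)
  sending the identity function to \<open>a\<close>. An element of \<open>C(\<sigma>(a))\<close> is represented by any total
  function that is continuous on \<open>\<sigma>(a)\<close>; by linearity and the isometry condition, \<open>\<Phi>\<close> depends
  only on the restriction of such a function to \<open>\<sigma>(a)\<close>.\<close>

definition is_functional_calculus :: "'a::cstar_algebra \<Rightarrow> ((complex \<Rightarrow> complex) \<Rightarrow> 'a) \<Rightarrow> bool" where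
  "is_functional_calculus a \<Phi> \<longleftrightarrow>
     (\<forall>f g. continuous_on (spectrum a) f \<longrightarrow> continuous_on (spectrum a) g \<longrightarrow>
        \<Phi> (\<lambda>z. f z + g z) = \<Phi> f + \<Phi> g \<and> \<Phi> (\<lambda>z. f z * g z) = \<Phi> f * \<Phi> g) \<and>
     (\<forall>c f. continuous_on (spectrum a) f \<longrightarrow> \<Phi> (\<lambda>z. c * f z) = c *\<^sub>C \<Phi> f) \<and>
     (\<forall>f. continuous_on (spectrum a) f \<longrightarrow> \<Phi> (\<lambda>z. cnj (f z)) = star (\<Phi> f)) \<and>
     \<Phi> (\<lambda>z. 1) = 1 \<and>
     \<Phi> (\<lambda>z. z) = a \<and>
     (\<forall>f. continuous_on (spectrum a) f \<longrightarrow> norm (\<Phi> f) = (SUP z\<in>spectrum a. cmod (f z)))"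

text \<open>For normal \<open>a\<close> such a \<open>\<Phi>\<close> exists and its values on functions continuous on \<open>\<sigma>(a)\<close> are
  uniquely determined; only for those functions is the value below meaningful.\<close>

definition cfc :: "'a::cstar_algebra \<Rightarrow> (complex \<Rightarrow> complex) \<Rightarrow> 'a" where
  "cfc a = (SOME \<Phi>. is_functional_calculus a \<Phi>)"

text \<open>Used for positive \<open>a\<close> and \<open>s > 0\<close>, where \<open>t \<mapsto> t powr s\<close> is continuous on \<open>[0,\<infinity>)\<close> (with
  \<open>0 powr s = 0\<close>) and \<open>\<sigma>(a)\<close> consists of reals \<open>z = Re z \<ge> 0\<close>.\<close>

definition cstar_powr :: "'a::cstar_algebra \<Rightarrow> real \<Rightarrow> 'a" where
  "cstar_powr a s = cfc a (\<lambda>z. complex_of_real (Re z powr s))"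

locale cstar_metric_space =
  fixes U :: "'u set" and d :: "'u \<Rightarrow> 'u \<Rightarrow> 'a::cstar_algebra"
  assumes nonempty: "U \<noteq> {}"
    and dist_positive: "\<lbrakk>x \<in> U; y \<in> U\<rbrakk> \<Longrightarrow> positive (d x y)"
    and dist_eq_0_iff: "\<lbrakk>x \<in> U; y \<in> U\<rbrakk> \<Longrightarrow> d x y = 0 \<longleftrightarrow> x = y"
    and dist_sym: "\<lbrakk>x \<in> U; y \<in> U\<rbrakk> \<Longrightarrow> d x y = d y x"
    and dist_triangle: "\<lbrakk>x \<in> U; y \<in> U; u \<in> U\<rbrakk> \<Longrightarrow> d x y \<preceq> d x u + d u y"
begin

definition converges_to :: "(nat \<Rightarrow> 'u) \<Rightarrow> 'u \<Rightarrow> bool" where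
  "converges_to x z \<longleftrightarrow> (\<lambda>n. norm (d (x n) z)) \<longlonglongrightarrow> 0"

definition cauchy_seq :: "(nat \<Rightarrow> 'u) \<Rightarrow> bool" where
  "cauchy_seq x \<longleftrightarrow> (\<forall>e>0. \<exists>N. \<forall>n\<ge>N. \<forall>m\<ge>N. norm (d (x n) (x m)) < e)"

end

locale complete_cstar_metric_space = cstar_metric_space U d
  for U :: "'u set" and d :: "'u \<Rightarrow> 'u \<Rightarrow> 'a::cstar_algebra" +
  assumes complete: "\<lbrakk>range x \<subseteq> U; cauchy_seq x\<rbrakk> \<Longrightarrow> \<exists>z\<in>U. converges_to x z"

definition interpolative_kannan ::
    "'u set \<Rightarrow> ('u \<Rightarrow> 'u \<Rightarrow> 'a::cstar_algebra) \<Rightarrow> ('u \<Rightarrow> 'u) \<Rightarrow> bool" where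
  "interpolative_kannan U d T \<longleftrightarrow>
     (\<exists>\<tau>\<in>{0<..<1}. \<exists>\<beta>\<in>{0<..<1}. \<forall>x\<in>U. \<forall>y\<in>U. T x \<noteq> x \<longrightarrow>
        d (T x) (T y) \<preceq> \<tau> *\<^sub>R (cstar_powr (d x (T x)) \<beta> * cstar_powr (d y (T y)) (1 - \<beta>)))"

end

theory Submission
  imports Defs "HOL-Computational_Algebra.Fundamental_Theorem_Algebra"
begin

text \<open>The theorem reduces to real numbers by taking norms. Two facts about \<open>C\<^sup>*\<close>-algebras make this
  possible: the norm is monotone on positive elements (\<open>norm_mono_positive\<close>), and
  \<open>norm (a\<^sup>s) \<le> (norm a) powr s\<close> for positive \<open>a\<close> (\<open>norm_cstar_powr_le\<close>). By monotonicity
  \<open>norm (d x y)\<close> is an ordinary metric. Suppose that \<open>T\<close> has no fixed point, so that the contraction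
  condition holds for all pairs of points, and iterate \<open>T\<close> from an arbitrary point. The lengths
  \<open>e\<^sub>n\<close> of the steps satisfy \<open>e\<^sub>n\<^sub>+\<^sub>1 \<le> \<tau> * e\<^sub>n powr \<beta> * e\<^sub>n\<^sub>+\<^sub>1 powr (1 - \<beta>)\<close>. As they are
  positive, this gives \<open>e\<^sub>n\<^sub>+\<^sub>1 \<le> \<tau> powr (1 / \<beta>) * e\<^sub>n\<close> (\<open>interpolative_step\<close>). Hence the orbit is
  Cauchy. Let \<open>z\<close> be its limit. The condition for the pair \<open>x\<^sub>n\<close>, \<open>z\<close> bounds
  \<open>norm (d (x\<^sub>n\<^sub>+\<^sub>1) (T z))\<close> by a constant times \<open>e\<^sub>n powr \<beta>\<close>, which tends to \<open>0\<close>; so \<open>T z = z\<close>,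
  a contradiction.

  Most of the work is the spectral theory behind the two facts. Its core is that a self-adjoint
  element has a spectral value of modulus equal to its norm (\<open>selfadjoint_norm_in_spectrum\<close>),
  obtained from an elementary form of the spectral radius formula (\<open>norm_attained_in_spectrum\<close>).
  With the spectral mapping theorem for polynomials, it follows that \<open>p \<mapsto> p(a)\<close> is isometric for
  the supremum norm on the spectrum (\<open>norm_apply_poly\<close>). As the spectrum is real and compact,
  polynomials are dense in its continuous functions, and the isometry extends to the continuous
  functional calculus (\<open>functional_calculus_exists\<close>). The bound on powers is read off from that;
  monotonicity of the norm needs only spectral mapping for linear polynomials.\<close>

section \<open>Complex scalar multiplication\<close>

lemma scaleC_0_left [simp]: "0 *\<^sub>C (x::'a::cstar_algebra) = 0"
  using scaleC_of_real[of 0 x] by simp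

lemma scaleC_0_right [simp]: "c *\<^sub>C (0::'a::cstar_algebra) = 0"
  using norm_scaleC[of c "0::'a"] by simp

lemma scaleC_1 [simp]: "1 *\<^sub>C (x::'a::cstar_algebra) = x"
  using scaleC_of_real[of 1 x] by simp

lemma scaleC_minus_left: "(- c) *\<^sub>C (x::'a::cstar_algebra) = - (c *\<^sub>C x)"
proof -
  have "(- c) *\<^sub>C x + c *\<^sub>C x = 0" by (simp flip: scaleC_add_left)
  then show ?thesis by (simp add: eq_neg_iff_add_eq_0)
qed

lemma scaleC_diff_left: "(c - c') *\<^sub>C (x::'a::cstar_algebra) = c *\<^sub>C x - c' *\<^sub>C x"
  using scaleC_add_left[of c "- c'" x] by (simp add: scaleC_minus_left)

lemma scaleC_minus_right: "c *\<^sub>C (- x) = - (c *\<^sub>C (x::'a::cstar_algebra))"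
proof -
  have "c *\<^sub>C (- x) + c *\<^sub>C x = 0" by (simp flip: scaleC_add_right)
  then show ?thesis by (simp add: eq_neg_iff_add_eq_0)
qed

lemma scaleC_diff_right: "c *\<^sub>C (x - y) = c *\<^sub>C x - c *\<^sub>C (y::'a::cstar_algebra)"
  using scaleC_add_right[of c x "- y"] by (simp add: scaleC_minus_right)

section \<open>Two-sided inverses\<close>

text \<open>A relation rather than an inverse function: in a noncommutative algebra the inverse is at first
  only known to exist, and the spectrum is defined by its existence.\<close>

definition inverses :: "'a::monoid_mult \<Rightarrow> 'a \<Rightarrow> bool" where
  "inverses x y \<longleftrightarrow> x * y = 1 \<and> y * x = 1"

lemma not_in_spectrum_iff: "c \<notin> spectrum a \<longleftrightarrow> (\<exists>b. inverses (a - c *\<^sub>C 1) b)"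
  by (auto simp: spectrum_def inverses_def)

lemma inverses_mult:
  assumes "inverses x y" "inverses x' y'"
  shows "inverses (x * x') (y' * y)"
proof -
  have "x * x' * (y' * y) = x * (x' * y') * y" "y' * y * (x * x') = y' * (y * x) * x'"
    by (simp_all only: mult.assoc)
  then show ?thesis using assms by (simp add: inverses_def)
qed

lemma inverses_scaleC:
  fixes x :: "'a::cstar_algebra"
  assumes "inverses x y" "c \<noteq> 0"
  shows "inverses (c *\<^sub>C x) ((1 / c) *\<^sub>C y)"
  using assms by (simp add: inverses_def mult_scaleC_left mult_scaleC_right scaleC_scaleC)

text \<open>The resolvent identity, which controls how much the inverse varies.\<close>

lemma inverses_diff:
  fixes x :: "'a::ring_1"
  assumes "inverses x y" "inverses x' y'"
  shows "y' - y = y * (x - x') * y'"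
proof -
  have "y * (x - x') * y' = (y * x) * y' - y * (x' * y')" by (simp add: algebra_simps)
  then show ?thesis using assms by (simp add: inverses_def)
qed

text \<open>The inverse is the Neumann series \<open>\<Sum>n. h ^ n\<close>, which converges absolutely.\<close>

lemma neumann_inverse:
  fixes h :: "'a::{real_normed_algebra_1,banach}"
  assumes "norm h < 1"
  shows "\<exists>y. inverses (1 - h) y"
proof -
  let ?y = "\<Sum>n. h ^ n"
  have s: "summable (\<lambda>n. h ^ n)" by (rule complete_algebra_summable_geometric[OF assms])
  have "(\<Sum>n. h ^ Suc n) = ?y - 1" using suminf_split_head[OF s] by simp
  moreover have "(\<Sum>n. h ^ Suc n) = h * ?y" using suminf_mult[OF s, of h] by simp
  moreover have "(\<Sum>n. h ^ Suc n) = ?y * h"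
    using suminf_mult2[OF s, of h] by (simp add: power_commutes)
  ultimately have "(1 - h) * ?y = 1" "?y * (1 - h) = 1" by (simp_all add: algebra_simps)
  then show ?thesis by (auto simp: inverses_def)
qed

text \<open>Write \<open>x' = x (1 - y (x - x'))\<close>; the second factor is invertible by the Neumann series.\<close>

lemma inverse_exists_nearby:
  fixes x :: "'a::{real_normed_algebra_1,banach}"
  assumes "inverses x y" "norm (x - x') * norm y < 1"
  shows "\<exists>y'. inverses x' y'"
proof -
  have "norm (y * (x - x')) < 1"
    using norm_mult_ineq[of y "x - x'"] assms(2) by (simp add: mult.commute)
  then obtain v where v: "inverses (1 - y * (x - x')) v" using neumann_inverse by blast
  have "x * (1 - y * (x - x')) = x - (x * y) * (x - x')" by (simp add: algebra_simps)
  then have "x * (1 - y * (x - x')) = x'" using assms(1) by (simp add: inverses_def)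
  then show ?thesis using inverses_mult[OF assms(1) v] by auto
qed

text \<open>By the resolvent identity, \<open>g z - g z0\<close> is bounded by \<open>norm (g z0) * norm (f z0 - f z) * norm (g z)\<close>.
  Near \<open>z0\<close> this first forces \<open>norm (g z) \<le> 2 * norm (g z0)\<close>, and then tends to \<open>0\<close>.\<close>

lemma continuous_on_inverses:
  fixes f :: "'b::metric_space \<Rightarrow> 'a::real_normed_algebra_1"
  assumes f: "continuous_on S f" and inv: "\<And>z. z \<in> S \<Longrightarrow> inverses (f z) (g z)"
  shows "continuous_on S g"
  unfolding continuous_on_def
proof
  fix z0 assume z0: "z0 \<in> S"
  let ?F = "at z0 within S"
  define M where "M = norm (g z0)"
  have lim: "((\<lambda>z. norm (f z0 - f z)) \<longlongrightarrow> 0) ?F"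
  proof -
    have "((\<lambda>z. f z0 - f z) \<longlongrightarrow> f z0 - f z0) ?F"
      using f z0 by (intro tendsto_diff tendsto_const) (auto simp: continuous_on_def)
    then show ?thesis by (intro tendsto_norm_zero) simp
  qed
  then have "((\<lambda>z. M * norm (f z0 - f z)) \<longlongrightarrow> 0) ?F" by (rule tendsto_mult_right_zero)
  then have small: "\<forall>\<^sub>F z in ?F. M * norm (f z0 - f z) < 1 / 2"
    by (rule order_tendstoD) simp
  have mem: "\<forall>\<^sub>F z in ?F. z \<in> S" by (simp add: eventually_at_filter)
  have "\<forall>\<^sub>F z in ?F. norm (g z - g z0) \<le> 2 * M * M * norm (f z0 - f z)"
    using small mem
  proof eventually_elim
    case (elim z)
    have eq: "g z - g z0 = g z0 * (f z0 - f z) * g z"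
      using inverses_diff[OF inv[OF z0] inv[OF elim(2)]] .
    have le: "norm (g z - g z0) \<le> M * norm (f z0 - f z) * norm (g z)"
      unfolding eq M_def
      by (rule order_trans[OF norm_mult_ineq mult_right_mono[OF norm_mult_ineq]]) simp
    also have "\<dots> \<le> 1 / 2 * norm (g z)"
      using elim(1) by (intro mult_right_mono) auto
    finally have "norm (g z) \<le> 2 * M"
      using norm_triangle_ineq2[of "g z" "g z0"] by (simp add: M_def)
    then have "M * norm (f z0 - f z) * norm (g z) \<le> M * norm (f z0 - f z) * (2 * M)"
      by (intro mult_left_mono) (auto simp: M_def)
    with le show ?case by (simp add: ac_simps)
  qed
  moreover have "((\<lambda>z. 2 * M * M * norm (f z0 - f z)) \<longlongrightarrow> 0) ?F"
    using lim by (rule tendsto_mult_right_zero)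
  ultimately have "((\<lambda>z. g z - g z0) \<longlongrightarrow> 0) ?F" by (rule Lim_null_comparison)
  then show "(g \<longlongrightarrow> g z0) ?F" by (simp add: LIM_zero_iff)
qed

section \<open>The spectral radius of an element with multiplicative dyadic powers\<close>

text \<open>The partial fraction decomposition
  \<open>1 / (1 - h\<^sup>2) = (1 / (1 - h) + 1 / (1 + h)) / 2\<close>. It passes from \<open>h\<close> to \<open>h\<^sup>2\<close> without
  increasing the size of differences of inverses, since averaging does not.\<close>

lemma inverses_average:
  fixes h :: "'a::real_normed_algebra_1"
  assumes "inverses (1 - h) y" "inverses (1 + h) y'"
  shows "inverses (1 - h * h) ((1 / 2) *\<^sub>R (y + y'))"
proof -
  have "(1 - h * h) * (y + y') = (1 + h) * ((1 - h) * y) + (1 - h) * ((1 + h) * y')"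
    "(y + y') * (1 - h * h) = (y * (1 - h)) * (1 + h) + (y' * (1 + h)) * (1 - h)"
    by (simp_all add: algebra_simps)
  then have "(1 - h * h) * (y + y') = 2" "(y + y') * (1 - h * h) = 2"
    using assms by (simp_all add: inverses_def)
  moreover have "(1 / 2) *\<^sub>R (2::'a) = 1"
    by (metis (no_types) divide_self_if of_real_numeral of_real_1 scaleR_conv_of_real
        of_real_mult times_divide_eq_left mult_1 zero_neq_numeral)
  ultimately show ?thesis by (simp add: inverses_def)
qed

text \<open>The hypothesis says that the spectral radius of \<open>a\<close> is its norm. The argument is Rickart's, which
  avoids vector-valued complex analysis. Suppose that no spectral value lies on the circle of radius
  \<open>norm a\<close>, and put \<open>\<rho> = 1 / norm a\<close>. Then the inverse of \<open>1 - z a\<close> exists and is uniformly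
  continuous on the closed disc of radius \<open>\<rho>\<close>, so for a suitable \<open>s < 1\<close> the inverses at \<open>z\<close> and
  at \<open>s z\<close> differ by at most \<open>1/8\<close> when \<open>z\<close> is on the boundary circle. With \<open>N = 2 ^ n\<close>,
  repeated averaging extends this to the inverses of \<open>1 - w a\<^sup>N\<close> and \<open>1 - s\<^sup>N w a\<^sup>N\<close> for
  \<open>cmod w = \<rho>\<^sup>N\<close>, with the same bound for every \<open>N\<close>. But \<open>s\<^sup>N w a\<^sup>N\<close> tends to \<open>0\<close>, which
  makes the inverse of \<open>1 - w a\<^sup>N\<close> close to \<open>1\<close>, whereas \<open>w a\<^sup>N\<close> has norm \<open>1\<close>.\<close>

lemma norm_attained_in_spectrum:
  fixes a :: "'a::cstar_algebra"
  assumes pow: "\<And>n. norm (a ^ 2 ^ n) = norm a ^ 2 ^ n"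
  shows "\<exists>c\<in>spectrum a. cmod c = norm a"
proof (cases "a = 0")
  case True
  then have "0 \<in> spectrum a" by (simp add: spectrum_def)
  then show ?thesis using True by auto
next
  case False
  show ?thesis
  proof (rule ccontr)
    assume no: "\<not> ?thesis"
    define \<rho> where "\<rho> = 1 / norm a"
    have \<rho>: "\<rho> > 0" "\<rho> * norm a = 1" using False by (simp_all add: \<rho>_def)
    \<comment> \<open>inside the disc by the Neumann series, on its boundary because \<open>1 / z\<close> is not a spectral value\<close>
    have "\<exists>y. inverses (1 - z *\<^sub>C a) y" if z: "z \<in> cball 0 \<rho>" for z
    proof (cases "cmod z < \<rho>")
      case True
      then have "norm (z *\<^sub>C a) < 1"
        using mult_strict_right_mono[OF True, of "norm a"] \<rho> False by (simp add: norm_scaleC)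
      then show ?thesis by (rule neumann_inverse)
    next
      case False
      with z have cz: "cmod z = \<rho>" by simp
      with \<rho> have z0: "z \<noteq> 0" by auto
      have "cmod (1 / z) = norm a" by (simp add: cz norm_divide \<rho>_def)
      with no obtain b where "inverses (a - (1 / z) *\<^sub>C 1) b"
        using not_in_spectrum_iff by metis
      then have "inverses ((- z) *\<^sub>C (a - (1 / z) *\<^sub>C 1)) ((1 / (- z)) *\<^sub>C b)"
        using z0 by (intro inverses_scaleC) auto
      moreover have "(- z) *\<^sub>C (a - (1 / z) *\<^sub>C 1) = 1 - z *\<^sub>C a"
        using z0 by (simp add: scaleC_diff_right scaleC_scaleC scaleC_minus_left)
      ultimately show ?thesis by auto
    qed
    then obtain g where g: "\<And>z. z \<in> cball 0 \<rho> \<Longrightarrow> inverses (1 - z *\<^sub>C a) (g z)"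
      by metis
    have "continuous_on (cball 0 \<rho>) (\<lambda>z. 1 - z *\<^sub>C a)"
    proof (rule continuous_on_diff[OF continuous_on_const])
      have "dist (z *\<^sub>C a) (z' *\<^sub>C a) = norm a * dist z z'" for z z'
        by (simp add: dist_norm norm_scaleC mult.commute flip: scaleC_diff_left)
      then have "(norm a)-lipschitz_on (cball 0 \<rho>) (\<lambda>z. z *\<^sub>C a)"
        by (intro lipschitz_onI) auto
      then show "continuous_on (cball 0 \<rho>) (\<lambda>z. z *\<^sub>C a)" by (rule lipschitz_on_continuous_on)
    qed
    then have "continuous_on (cball 0 \<rho>) g" using g by (rule continuous_on_inverses)
    then have "uniformly_continuous_on (cball 0 \<rho>) g"
      by (rule compact_uniformly_continuous) simp
    then obtain \<delta> where \<delta>: "\<delta> > 0"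
      "\<And>z z'. z \<in> cball 0 \<rho> \<Longrightarrow> z' \<in> cball 0 \<rho> \<Longrightarrow> dist z' z < \<delta> \<Longrightarrow> dist (g z') (g z) < 1 / 8"
      unfolding uniformly_continuous_on_def
      by (metis zero_less_divide_1_iff zero_less_numeral)
    define s where "s = 1 - min (1 / 2) (\<delta> / (2 * \<rho>))"
    have s: "0 < s" "s < 1" "(1 - s) * \<rho> < \<delta>"
    proof -
      show "0 < s" "s < 1" using \<rho> \<delta> by (auto simp: s_def)
      have "(1 - s) * \<rho> \<le> \<delta> / (2 * \<rho>) * \<rho>" using \<rho> by (intro mult_right_mono) (auto simp: s_def)
      also have "\<dots> < \<delta>" using \<rho> \<delta> by simp
      finally show "(1 - s) * \<rho> < \<delta>" .
    qed
    have resolvents_close: "\<exists>y y'. inverses (1 - w *\<^sub>C a ^ 2 ^ n) y \<and>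
        inverses (1 - (complex_of_real (s ^ 2 ^ n) * w) *\<^sub>C a ^ 2 ^ n) y' \<and> norm (y - y') \<le> 1 / 8"
      if "cmod w = \<rho> ^ 2 ^ n" for w n
      using that
    proof (induction n arbitrary: w)
      case 0
      let ?v = "complex_of_real s * w"
      have "cmod ?v \<le> \<rho>" using 0 s \<rho> by (simp add: norm_mult mult_le_cancel_right1)
      then have "w \<in> cball 0 \<rho>" "?v \<in> cball 0 \<rho>" using 0 by simp_all
      moreover have "dist w ?v < \<delta>"
      proof -
        have "w - ?v = complex_of_real (1 - s) * w" by (simp add: algebra_simps)
        then have "norm (w - ?v) = (1 - s) * \<rho>"
          using 0 s by (simp only: norm_mult norm_of_real) simp
        with s show ?thesis by (simp add: dist_norm)
      qed
      ultimately have "inverses (1 - w *\<^sub>C a) (g w)" "inverses (1 - ?v *\<^sub>C a) (g ?v)"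
        "norm (g w - g ?v) \<le> 1 / 8"
        using g \<delta>(2)[of ?v w] by (auto simp: dist_norm)
      then show ?case by auto
    next
      case (Suc n)
      define b where "b = a ^ 2 ^ n"
      define r where "r = complex_of_real (s ^ 2 ^ n)"
      \<comment> \<open>the bound for \<open>v\<close> and \<open>- v\<close>, the two square roots of \<open>w\<close>, gives the one for \<open>w\<close>\<close>
      define v where "v = csqrt w"
      have vv: "v * v = w" by (simp add: v_def flip: power2_eq_square)
      have "(cmod v)\<^sup>2 = (\<rho> ^ 2 ^ n)\<^sup>2"
        using Suc.prems by (simp only: power2_eq_square vv flip: norm_mult) (simp add: mult_2 power_add)
      then have "cmod v = \<rho> ^ 2 ^ n" using \<rho> by simp
      then have "cmod v = \<rho> ^ 2 ^ n" "cmod (- v) = \<rho> ^ 2 ^ n" by simp_all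
      then obtain y1 z1 y2 z2 where 1: "inverses (1 - v *\<^sub>C b) y1" "inverses (1 - (r * v) *\<^sub>C b) z1"
        "norm (y1 - z1) \<le> 1 / 8" and 2: "inverses (1 + v *\<^sub>C b) y2"
        "inverses (1 + (r * v) *\<^sub>C b) z2" "norm (y2 - z2) \<le> 1 / 8"
        using Suc.IH[of v] Suc.IH[of "- v"] unfolding b_def r_def
        by (auto simp: scaleC_minus_left)
      have sq: "(u *\<^sub>C b) * (u *\<^sub>C b) = (u * u) *\<^sub>C a ^ 2 ^ Suc n" for u
        by (simp add: b_def mult_scaleC_left mult_scaleC_right scaleC_scaleC mult_2 power_add)
      have rr: "r * v * (r * v) = complex_of_real (s ^ 2 ^ Suc n) * w"
        by (simp add: r_def mult_2 power_add ac_simps flip: vv)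
      have "(1 / 2) *\<^sub>R (y1 + y2) - (1 / 2) *\<^sub>R (z1 + z2) = (1 / 2) *\<^sub>R ((y1 - z1) + (y2 - z2))"
        by (simp add: algebra_simps)
      then have "norm ((1 / 2) *\<^sub>R (y1 + y2) - (1 / 2) *\<^sub>R (z1 + z2)) = 1 / 2 * norm ((y1 - z1) + (y2 - z2))"
        by simp
      also have "\<dots> \<le> 1 / 2 * (1 / 8 + 1 / 8)"
        using norm_triangle_mono[OF 1(3) 2(3)] by simp
      finally have "norm ((1 / 2) *\<^sub>R (y1 + y2) - (1 / 2) *\<^sub>R (z1 + z2)) \<le> 1 / 8" by simp
      with inverses_average[OF 1(1) 2(1)] inverses_average[OF 1(2) 2(2)]
      show ?case unfolding sq vv rr by blast
    qed
    have "(\<lambda>n. s ^ 2 ^ n) \<longlonglongrightarrow> 0"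
    proof -
      have "filterlim (\<lambda>n. 2 ^ n :: nat) sequentially sequentially"
        by (rule filterlim_subseq) (simp add: strict_mono_def)
      moreover have "(\<lambda>n. s ^ n) \<longlonglongrightarrow> 0" using s by (intro LIMSEQ_power_zero) simp
      ultimately show ?thesis by (rule filterlim_compose[rotated])
    qed
    then have "\<forall>\<^sub>F n in sequentially. s ^ 2 ^ n < 1 / 9" by (rule order_tendstoD) simp
    then obtain n where n: "s ^ 2 ^ n < 1 / 9" by (auto simp: eventually_sequentially)
    \<comment> \<open>from here on, one exponent with \<open>s ^ 2 ^ n\<close> below \<open>1/9\<close> gives the contradiction\<close>
    define w where "w = complex_of_real (\<rho> ^ 2 ^ n)"
    define h where "h = w *\<^sub>C a ^ 2 ^ n"
    have w: "cmod w = \<rho> ^ 2 ^ n" using \<rho> by (simp add: w_def norm_power)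
    have h: "norm h = 1"
      using \<rho> w pow[of n] by (simp add: h_def norm_scaleC flip: power_mult_distrib)
    obtain y y' where y: "inverses (1 - h) y"
      and y': "inverses (1 - complex_of_real (s ^ 2 ^ n) *\<^sub>C h) y'" and yy': "norm (y - y') \<le> 1 / 8"
      using resolvents_close[OF w] unfolding h_def by (auto simp: scaleC_scaleC)
    have "y' - 1 = (s ^ 2 ^ n) *\<^sub>R (h * y')"
      using y' by (simp add: inverses_def algebra_simps scaleC_of_real del: of_real_power)
    then have "norm (y' - 1) = s ^ 2 ^ n * norm (h * y')" using s by simp
    also have "\<dots> \<le> 1 / 9 * norm y'"
      using n h s norm_mult_ineq[of h y'] by (intro mult_mono) auto
    finally have "norm (y' - 1) \<le> 1 / 9 * norm y'" .
    moreover have "norm y' \<le> norm (y' - 1) + 1" using norm_triangle_ineq[of "y' - 1" 1] by simp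
    ultimately have "norm (y' - 1) \<le> 1 / 8" by linarith
    with yy' have y1: "norm (y - 1) \<le> 1 / 4" using norm_triangle_ineq[of "y - y'" "y' - 1"] by simp
    have "h = y - 1 - (y - 1) * h"
      using y by (simp add: inverses_def algebra_simps)
    then have "norm h \<le> norm (y - 1) + norm ((y - 1) * h)"
      using norm_triangle_ineq4[of "y - 1" "(y - 1) * h"] by simp
    also have "\<dots> \<le> 1 / 4 + 1 / 4 * 1"
      using y1 h norm_mult_ineq[of "y - 1" h] by auto
    finally show False using h by simp
  qed
qed

section \<open>Spectra of self-adjoint elements\<close>

lemma norm_star [simp]: "norm (star x) = norm (x::'a::cstar_algebra)"
proof -
  have le: "norm y \<le> norm (star y)" for y :: 'a
  proof (cases "y = 0")
    case False
    have "norm y * norm y \<le> norm (star y) * norm y"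
      using cstar_identity[of y] norm_mult_ineq[of "star y" y] by (simp add: power2_eq_square)
    with False show ?thesis by simp
  qed simp
  show ?thesis using le[of x] le[of "star x"] by (simp add: star_star)
qed

lemma star_0 [simp]: "star (0::'a::cstar_algebra) = 0"
  by (metis norm_star norm_eq_zero)

lemma star_1 [simp]: "star (1::'a::cstar_algebra) = 1"
  using star_mult[of "star 1" "1::'a"] by (simp add: star_star)

lemma star_minus: "star (- x) = - star (x::'a::cstar_algebra)"
proof -
  have "star (- x) + star x = 0" by (simp flip: star_add)
  then show ?thesis by (simp add: eq_neg_iff_add_eq_0)
qed

lemma star_diff: "star (x - y) = star x - star (y::'a::cstar_algebra)"
  using star_add[of x "- y"] by (simp add: star_minus)

lemma star_power: "star (x ^ n) = star (x::'a::cstar_algebra) ^ n"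
  by (induction n) (simp_all add: star_mult power_commutes)

lemma spectrum_norm_bound:
  fixes a :: "'a::cstar_algebra"
  assumes "c \<in> spectrum a"
  shows "cmod c \<le> norm a"
proof (rule ccontr)
  assume "\<not> ?thesis"
  then have c: "norm a < cmod c" by simp
  then have c0: "c \<noteq> 0" by auto
  have "norm ((1 / c) *\<^sub>C a) < 1" using c c0 by (simp add: norm_scaleC norm_divide divide_simps)
  then obtain y where "inverses (1 - (1 / c) *\<^sub>C a) y" using neumann_inverse by blast
  then have "inverses ((- c) *\<^sub>C (1 - (1 / c) *\<^sub>C a)) ((1 / (- c)) *\<^sub>C y)"
    using c0 by (intro inverses_scaleC) auto
  moreover have "(- c) *\<^sub>C (1 - (1 / c) *\<^sub>C a) = a - c *\<^sub>C 1"
    using c0 by (simp add: scaleC_diff_right scaleC_scaleC scaleC_minus_left)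
  ultimately show False using assms not_in_spectrum_iff by metis
qed

text \<open>The spectrum is bounded by the norm, and its complement is open because elements close to an
  invertible one are invertible.\<close>

lemma spectrum_compact: "compact (spectrum (a::'a::cstar_algebra))"
proof -
  have "open (- spectrum a)"
  proof (rule openI)
    fix c assume "c \<in> - spectrum a"
    then obtain b where b: "inverses (a - c *\<^sub>C 1) b" using not_in_spectrum_iff by blast
    have "ball c (1 / (norm b + 1)) \<subseteq> - spectrum a"
    proof
      fix c' assume "c' \<in> ball c (1 / (norm b + 1))"
      then have "cmod (c' - c) < 1 / (norm b + 1)"
        by (simp add: dist_norm norm_minus_commute)
      moreover have pos: "norm b + 1 > 0" by (simp add: add_nonneg_pos)
      ultimately have lt: "cmod (c' - c) * (norm b + 1) < 1" by (simp add: field_simps)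
      have "cmod (c' - c) * norm b \<le> cmod (c' - c) * (norm b + 1)" by (intro mult_left_mono) auto
      with lt have "cmod (c' - c) * norm b < 1" by linarith
      moreover have "(a - c *\<^sub>C 1) - (a - c' *\<^sub>C 1) = (c' - c) *\<^sub>C 1" by (simp add: scaleC_diff_left)
      ultimately have "norm ((a - c *\<^sub>C 1) - (a - c' *\<^sub>C 1)) * norm b < 1" by (simp only: norm_scaleC) simp
      from inverse_exists_nearby[OF b this] show "c' \<in> - spectrum a"
        using not_in_spectrum_iff by blast
    qed
    then show "\<exists>e>0. ball c e \<subseteq> - spectrum a"
      by (intro exI[of _ "1 / (norm b + 1)"]) (simp add: add_nonneg_pos)
  qed
  moreover have "bounded (spectrum a)"
    using spectrum_norm_bound by (auto simp: bounded_iff)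
  ultimately show ?thesis by (simp add: compact_eq_bounded_closed closed_def)
qed

text \<open>For self-adjoint elements the \<open>C\<^sup>*\<close>-identity reads \<open>norm (b\<^sup>2) = (norm b)\<^sup>2\<close>; iterating it gives
  the norms of the dyadic powers.\<close>

lemma selfadjoint_norm_in_spectrum:
  fixes a :: "'a::cstar_algebra"
  assumes "star a = a"
  shows "\<exists>c\<in>spectrum a. cmod c = norm a"
proof (rule norm_attained_in_spectrum)
  show "norm (a ^ 2 ^ n) = norm a ^ 2 ^ n" for n
  proof (induction n)
    case (Suc n)
    have "norm (a ^ 2 ^ Suc n) = (norm (a ^ 2 ^ n))\<^sup>2"
      using cstar_identity[of "a ^ 2 ^ n"] assms by (simp add: star_power mult_2 flip: power_add)
    also have "\<dots> = norm a ^ 2 ^ Suc n"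
      using Suc by (simp add: mult.commute flip: power_mult)
    finally show ?case .
  qed simp
qed

text \<open>Translate by \<open>\<i> t\<close> for real \<open>t\<close>. By the \<open>C\<^sup>*\<close>-identity the norm of \<open>a + \<i> t\<close> is at most
  \<open>sqrt ((norm a)\<^sup>2 + t\<^sup>2)\<close>. If \<open>Im c\<close> were not \<open>0\<close>, the spectral value \<open>c + \<i> t\<close> would exceed
  this bound for large \<open>t\<close> of the sign of \<open>Im c\<close>.\<close>

lemma selfadjoint_spectrum_real:
  fixes a :: "'a::cstar_algebra"
  assumes a: "star a = a" and c: "c \<in> spectrum a"
  shows "c \<in> \<real>"
proof (rule ccontr)
  assume "c \<notin> \<real>"
  then have im: "Im c \<noteq> 0" by (simp add: complex_is_Real_iff)
  have bound: "(Im c + t)\<^sup>2 \<le> (norm a)\<^sup>2 + t\<^sup>2" for t :: real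
  proof -
    let ?b = "a + (\<i> * t) *\<^sub>C 1"
    have "?b - (c + \<i> * t) *\<^sub>C 1 = a - c *\<^sub>C 1" by (simp add: scaleC_add_left)
    then have "c + \<i> * t \<in> spectrum ?b" using c not_in_spectrum_iff by metis
    then have "cmod (c + \<i> * t) \<le> norm ?b" by (rule spectrum_norm_bound)
    then have "(cmod (c + \<i> * t))\<^sup>2 \<le> (norm ?b)\<^sup>2" by (intro power_mono) auto
    also have "\<dots> = norm (star ?b * ?b)" by (rule cstar_identity[symmetric])
    also have "star ?b * ?b = a * a + (t\<^sup>2) *\<^sub>R 1"
      by (simp add: star_add star_scaleC a algebra_simps mult_scaleC_left mult_scaleC_right
          scaleC_scaleC scaleC_minus_left scaleC_diff_right power2_eq_square flip: scaleC_of_real)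
    also have "norm \<dots> \<le> norm (a * a) + norm ((t\<^sup>2) *\<^sub>R (1::'a))" by (rule norm_triangle_ineq)
    also have "\<dots> \<le> (norm a)\<^sup>2 + t\<^sup>2"
      using norm_mult_ineq[of a a] by (simp add: power2_eq_square)
    finally have "(Re c)\<^sup>2 + (Im c + t)\<^sup>2 \<le> (norm a)\<^sup>2 + t\<^sup>2" by (simp add: cmod_power2)
    then show ?thesis using zero_le_power2[of "Re c"] by linarith
  qed
  have "(Im c)\<^sup>2 + 2 * Im c * t \<le> (norm a)\<^sup>2" for t
    using bound[of t] by (simp add: power2_sum)
  \<comment> \<open>chosen so that \<open>2 * Im c * t = (norm a)\<^sup>2 + 1\<close>\<close>
  from this[of "((norm a)\<^sup>2 + 1) / (2 * Im c)"] show False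
    using im zero_le_power2[of "Im c"] by simp
qed

section \<open>The polynomial calculus\<close>

text \<open>Evaluation by Horner's rule. The coefficients are complex numbers and not elements of the algebra,
  so that this is a homomorphism although the algebra need not be commutative.\<close>

definition apply_poly :: "'a::cstar_algebra \<Rightarrow> complex poly \<Rightarrow> 'a" where
  "apply_poly a p = fold_coeffs (\<lambda>c y. c *\<^sub>C 1 + a * y) p 0"

lemma apply_poly_0 [simp]: "apply_poly a 0 = 0"
  by (simp add: apply_poly_def)

lemma apply_poly_pCons [simp]: "apply_poly a (pCons c p) = c *\<^sub>C 1 + a * apply_poly a p"
  by (cases "p = 0"; cases "c = 0") (simp_all add: apply_poly_def)

lemma apply_poly_1 [simp]: "apply_poly a 1 = 1"
  by (simp add: one_pCons)

lemma apply_poly_add: "apply_poly a (p + q) = apply_poly a p + apply_poly a q"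
  by (induction p q rule: poly_induct2) (simp_all add: scaleC_add_left algebra_simps)

lemma apply_poly_smult: "apply_poly a (smult c p) = c *\<^sub>C apply_poly a p"
  by (induction p) (simp_all add: scaleC_add_right scaleC_scaleC mult_scaleC_right)

lemma apply_poly_diff: "apply_poly a (p - q) = apply_poly a p - apply_poly a q"
  using apply_poly_add[of a "p - q" q] by simp

lemma apply_poly_mult: "apply_poly a (p * q) = apply_poly a p * apply_poly a q"
  by (induction p)
    (simp_all add: apply_poly_add apply_poly_smult mult_scaleC_left algebra_simps)

lemma apply_poly_commutes: "a * apply_poly a p = apply_poly a p * a"
  using apply_poly_mult[of a "[:0, 1:]" p] apply_poly_mult[of a p "[:0, 1:]"]
  by (simp add: mult.commute)

lemma apply_poly_star:
  assumes "star a = a"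
  shows "apply_poly a (map_poly cnj p) = star (apply_poly a p)"
proof (induction p)
  case (pCons c p)
  have "star (apply_poly a p) * a = a * star (apply_poly a p)"
    using arg_cong[OF apply_poly_commutes, of star a p] by (simp add: star_mult assms)
  with pCons show ?case by (simp add: map_poly_pCons star_add star_mult star_scaleC assms)
qed simp

lemma poly_map_cnj_real:
  assumes "z \<in> \<real>"
  shows "poly (map_poly cnj p) z = cnj (poly p z)"
  using assms by (induction p) (simp_all add: map_poly_pCons Reals_cnj_iff)

text \<open>The polynomial \<open>p - p(z)\<close> is a multiple of \<open>X - z\<close>, so an inverse of \<open>p(a) - p(z)\<close> would yield
  an inverse of \<open>a - z\<close>.\<close>

lemma poly_value_in_spectrum:
  assumes "z \<in> spectrum a"
  shows "poly p z \<in> spectrum (apply_poly a p)"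
proof (rule ccontr)
  assume "\<not> ?thesis"
  then obtain b where b: "inverses (apply_poly a p - poly p z *\<^sub>C 1) b"
    using not_in_spectrum_iff by blast
  have "poly (p - [:poly p z:]) z = 0" by simp
  then obtain q where "p - [:poly p z:] = [:- z, 1:] * q"
    by (metis poly_eq_0_iff_dvd dvdE)
  then have "apply_poly a (p - [:poly p z:]) = apply_poly a [:- z, 1:] * apply_poly a q"
    "apply_poly a (p - [:poly p z:]) = apply_poly a q * apply_poly a [:- z, 1:]"
    by (simp_all only: apply_poly_mult flip: apply_poly_mult) (simp add: mult.commute)
  moreover have "apply_poly a [:- z, 1:] = a - z *\<^sub>C 1" by (simp add: scaleC_minus_left)
  ultimately have l: "(a - z *\<^sub>C 1) * (apply_poly a q * b) = 1"
    and r: "(b * apply_poly a q) * (a - z *\<^sub>C 1) = 1"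
    using b by (simp_all add: inverses_def apply_poly_diff mult.assoc)
  \<comment> \<open>a left inverse and a right inverse agree\<close>
  have "b * apply_poly a q = apply_poly a q * b"
    using l r by (metis mult.assoc mult.left_neutral mult.right_neutral)
  with l r show False using assms by (auto simp: spectrum_def)
qed

text \<open>By the fundamental theorem of algebra \<open>p\<close> is a product of linear factors \<open>X - z\<close>, and each
  \<open>a - z\<close> is invertible.\<close>

lemma apply_poly_inverse_exists:
  fixes a :: "'a::cstar_algebra"
  assumes "p \<noteq> 0" "\<And>z. poly p z = 0 \<Longrightarrow> z \<notin> spectrum a"
  shows "\<exists>b. inverses (apply_poly a p) b"
  using assms
proof (induction "degree p" arbitrary: p)
  case 0
  then obtain c where "p = [:c:]" "c \<noteq> 0" by (metis degree_eq_zeroE pCons_0_0)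
  then show ?case using inverses_scaleC[of "1::'a" 1 c] by (auto simp: inverses_def)
next
  case (Suc n)
  have "\<not> constant (poly p)" using Suc.hyps by (simp add: constant_degree)
  then obtain z where z: "poly p z = 0" using fundamental_theorem_of_algebra by blast
  then obtain q where pq: "p = [:- z, 1:] * q"
    by (metis poly_eq_0_iff_dvd dvdE)
  with Suc.prems have q0: "q \<noteq> 0" by auto
  have "degree p = degree [:- z, 1:] + degree q" unfolding pq using q0 by (intro degree_mult_eq) auto
  with Suc.hyps have "n = degree q" by simp
  with Suc q0 obtain b where "inverses (apply_poly a q) b" by (metis pq poly_mult mult_zero_right)
  moreover obtain b' where "inverses (apply_poly a [:- z, 1:]) b'"
    using Suc.prems(2)[OF z] not_in_spectrum_iff[of z a] by (auto simp: scaleC_minus_left)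
  ultimately show ?case unfolding pq apply_poly_mult using inverses_mult by blast
qed

lemma selfadjoint_spectrum_nonempty:
  fixes a :: "'a::cstar_algebra"
  assumes "star a = a"
  shows "spectrum a \<noteq> {}"
  using selfadjoint_norm_in_spectrum[OF assms] by auto

text \<open>The spectral mapping theorem for polynomials. Nonemptiness of the spectrum matters for constant
  polynomials.\<close>

lemma spectrum_apply_poly:
  fixes a :: "'a::cstar_algebra"
  assumes "spectrum a \<noteq> {}"
  shows "spectrum (apply_poly a p) = poly p ` spectrum a"
proof
  show "poly p ` spectrum a \<subseteq> spectrum (apply_poly a p)" using poly_value_in_spectrum by blast
  show "spectrum (apply_poly a p) \<subseteq> poly p ` spectrum a"
  proof
    fix c assume c: "c \<in> spectrum (apply_poly a p)"
    show "c \<in> poly p ` spectrum a"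
    proof (cases "p = [:c:]")
      case True
      with assms show ?thesis by auto
    next
      case False
      have "apply_poly a (p - [:c:]) = apply_poly a p - c *\<^sub>C 1" by (simp add: apply_poly_diff)
      then have "\<not> (\<exists>b. inverses (apply_poly a (p - [:c:])) b)"
        using c not_in_spectrum_iff by metis
      with apply_poly_inverse_exists[of "p - [:c:]" a] False
      obtain z where "z \<in> spectrum a" "poly (p - [:c:]) z = 0" by auto
      then show ?thesis by (auto intro!: image_eqI[of _ _ z])
    qed
  qed
qed

text \<open>Together the two parts say that \<open>norm (p(a))\<close> is the maximum of \<open>cmod p\<close> on the spectrum. When
  \<open>p(a)\<close> is self-adjoint this holds by spectral mapping; the general case reduces to it by passing to
  \<open>star (p(a)) * p(a)\<close>, which is the value at \<open>a\<close> of the polynomial that equals \<open>(cmod p)\<^sup>2\<close> on the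
  real line.\<close>

lemma norm_apply_poly:
  fixes a :: "'a::cstar_algebra"
  assumes a: "star a = a"
  shows norm_poly_value_le: "z \<in> spectrum a \<Longrightarrow> cmod (poly p z) \<le> norm (apply_poly a p)"
    and norm_apply_poly_attained: "\<exists>z\<in>spectrum a. cmod (poly p z) = norm (apply_poly a p)"
proof -
  show "cmod (poly p z) \<le> norm (apply_poly a p)" if "z \<in> spectrum a"
    using spectrum_norm_bound poly_value_in_spectrum that by blast
  let ?q = "map_poly cnj p * p"
  have q: "apply_poly a ?q = star (apply_poly a p) * apply_poly a p"
    by (simp add: apply_poly_mult apply_poly_star a)
  then have "star (apply_poly a ?q) = apply_poly a ?q" by (simp add: star_mult star_star)
  from selfadjoint_norm_in_spectrum[OF this]
  obtain c where c: "c \<in> spectrum (apply_poly a ?q)" "cmod c = norm (apply_poly a ?q)" by blast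
  then obtain z where z: "z \<in> spectrum a" "c = poly ?q z"
    using spectrum_apply_poly[OF selfadjoint_spectrum_nonempty[OF a]] by blast
  have "c = cnj (poly p z) * poly p z"
    unfolding z(2) poly_mult poly_map_cnj_real[OF selfadjoint_spectrum_real[OF a z(1)]] ..
  then have "(cmod (poly p z))\<^sup>2 = cmod c" by (simp add: norm_mult power2_eq_square)
  also have "\<dots> = (norm (apply_poly a p))\<^sup>2" using c(2) by (simp add: q cstar_identity)
  finally show "\<exists>z\<in>spectrum a. cmod (poly p z) = norm (apply_poly a p)"
    using z(1) by auto
qed

section \<open>The continuous functional calculus of a self-adjoint element\<close>

text \<open>The spectrum is a compact set of reals, so the real Weierstrass theorem applies to the real and
  the imaginary part of \<open>f\<close> separately. On a general compact subset of the plane the statement fails.\<close>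

lemma poly_dense_on_spectrum:
  fixes a :: "'a::cstar_algebra"
  assumes a: "star a = a" and f: "continuous_on (spectrum a) f" and e: "e > 0"
  shows "\<exists>p. \<forall>z\<in>spectrum a. cmod (f z - poly p z) < e"
proof -
  define K where "K = Re ` spectrum a"
  have K: "compact K"
    unfolding K_def by (intro compact_continuous_image spectrum_compact continuous_intros)
  have real: "complex_of_real (Re z) = z" if "z \<in> spectrum a" for z
    using selfadjoint_spectrum_real[OF a that] by (simp add: complex_eq_iff complex_is_Real_iff)
  have cont: "continuous_on K (\<lambda>t. f (complex_of_real t))"
    by (rule continuous_on_compose2[OF f]) (auto simp: K_def real intro!: continuous_intros)
  have real_approx: "\<exists>p. \<forall>z\<in>spectrum a. cmod (complex_of_real (h (Re z)) - poly p z) < e / 2"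
    if "continuous_on K h" for h :: "real \<Rightarrow> real"
  proof -
    have "e / 2 > 0" using e by simp
    with K that obtain g where g: "real_polynomial_function g" "\<And>t. t \<in> K \<Longrightarrow> \<bar>h t - g t\<bar> < e / 2"
      by (rule Stone_Weierstrass_real_polynomial_function) blast
    then obtain c n where cn: "g = (\<lambda>t. \<Sum>i\<le>n. c i * t ^ i)"
      by (auto simp: real_polynomial_function_iff_sum)
    define p where "p = (\<Sum>i\<le>n. monom (complex_of_real (c i)) i)"
    have "poly p z = complex_of_real (g (Re z))" if "z \<in> spectrum a" for z
    proof -
      have "poly p (complex_of_real (Re z)) = complex_of_real (g (Re z))"
        by (simp add: p_def cn poly_sum poly_monom)
      with real[OF that] show ?thesis by simp
    qed
    then have "\<forall>z\<in>spectrum a. cmod (complex_of_real (h (Re z)) - poly p z) < e / 2"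
      using g(2) by (auto simp: K_def simp flip: of_real_diff)
    then show ?thesis by blast
  qed
  obtain p q where p: "\<And>z. z \<in> spectrum a \<Longrightarrow> cmod (complex_of_real (Re (f (complex_of_real (Re z)))) - poly p z) < e / 2"
    and q: "\<And>z. z \<in> spectrum a \<Longrightarrow> cmod (complex_of_real (Im (f (complex_of_real (Re z)))) - poly q z) < e / 2"
    using real_approx[OF continuous_on_Re[OF cont]] real_approx[OF continuous_on_Im[OF cont]]
    by blast
  have "cmod (f z - poly (p + smult \<i> q) z) < e" if z: "z \<in> spectrum a" for z
  proof -
    have "f z - poly (p + smult \<i> q) z = (complex_of_real (Re (f z)) - poly p z)
        + \<i> * (complex_of_real (Im (f z)) - poly q z)"
      by (subst (1) complex_eq) (simp add: algebra_simps)
    also have "cmod \<dots> \<le> cmod (complex_of_real (Re (f z)) - poly p z)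
        + cmod (complex_of_real (Im (f z)) - poly q z)"
      by (rule order_trans[OF norm_triangle_ineq]) (simp add: norm_mult)
    also have "\<dots> < e" using p[OF z] q[OF z] by (simp add: real[OF z])
    finally show ?thesis .
  qed
  then show ?thesis by blast
qed

text \<open>The functional calculus is first a relation: \<open>y\<close> is a limit of \<open>p\<^sub>n(a)\<close> for some polynomials
  \<open>p\<^sub>n\<close> tending uniformly to \<open>f\<close>. The algebraic laws then follow from limit theorems, and
  independence of the sequence \<open>p\<^sub>n\<close> follows afterwards from the norm formula.\<close>

definition is_calculus_value :: "'a::cstar_algebra \<Rightarrow> (complex \<Rightarrow> complex) \<Rightarrow> 'a \<Rightarrow> bool" where
  "is_calculus_value a f y \<longleftrightarrow> (\<exists>p. uniform_limit (spectrum a) (\<lambda>n. poly (p n)) f sequentially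
     \<and> (\<lambda>n. apply_poly a (p n)) \<longlonglongrightarrow> y)"

text \<open>By \<open>norm_apply_poly_attained\<close>, \<open>p \<mapsto> p(a)\<close> is isometric for the supremum norm, so a uniformly
  convergent sequence of polynomials gives a Cauchy sequence in the algebra.\<close>

lemma calculus_value_exists:
  fixes a :: "'a::cstar_algebra"
  assumes a: "star a = a" and f: "continuous_on (spectrum a) f"
  shows "\<exists>y. is_calculus_value a f y"
proof -
  obtain p where p: "\<And>n z. z \<in> spectrum a \<Longrightarrow> cmod (f z - poly (p n) z) < 1 / real (Suc n)"
    using poly_dense_on_spectrum[OF a f, of "1 / real (Suc n)" for n] by (metis of_nat_0_less_iff zero_less_Suc zero_less_divide_1_iff)
  have small: "\<exists>N. \<forall>n\<ge>N. 1 / real (Suc n) < e" if e: "e > 0" for e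
  proof -
    obtain N where N: "1 / real (Suc N) < e" using e by (rule nat_approx_posE)
    have "1 / real (Suc n) < e" if "n \<ge> N" for n
      using N that by (smt (verit) frac_le of_nat_0_less_iff of_nat_le_iff zero_less_Suc Suc_le_mono)
    then show ?thesis by blast
  qed
  have "uniform_limit (spectrum a) (\<lambda>n. poly (p n)) f sequentially"
    unfolding uniform_limit_sequentially_iff dist_norm
    using p small by (metis norm_minus_commute order.strict_trans)
  moreover have "Cauchy (\<lambda>n. apply_poly a (p n))"
  proof (rule CauchyI)
    fix e :: real assume "e > 0"
    then obtain N where N: "\<And>n. n \<ge> N \<Longrightarrow> 1 / real (Suc n) < e / 2" using small[of "e / 2"] by auto
    have "norm (apply_poly a (p m) - apply_poly a (p n)) < e" if mn: "m \<ge> N" "n \<ge> N" for m n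
    proof -
      obtain z where z: "z \<in> spectrum a"
        "cmod (poly (p m - p n) z) = norm (apply_poly a (p m - p n))"
        using norm_apply_poly_attained[OF a] by blast
      have "poly (p m - p n) z = (f z - poly (p n) z) - (f z - poly (p m) z)" by simp
      then have "cmod (poly (p m - p n) z) \<le> cmod (f z - poly (p n) z) + cmod (f z - poly (p m) z)"
        by (metis norm_triangle_ineq4)
      also have "\<dots> < e" using p[OF z(1), of n] p[OF z(1), of m] N[OF mn(1)] N[OF mn(2)] by linarith
      finally show ?thesis using z(2) by (simp add: apply_poly_diff)
    qed
    then show "\<exists>M. \<forall>m\<ge>M. \<forall>n\<ge>M. norm (apply_poly a (p m) - apply_poly a (p n)) < e" by blast
  qed
  ultimately show ?thesis
    unfolding is_calculus_value_def using Cauchy_convergent convergent_def by blast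
qed

lemma calculus_value_poly: "is_calculus_value a (poly p) (apply_poly a p)"
  unfolding is_calculus_value_def by (intro exI[of _ "\<lambda>n. p"]) (simp add: uniform_limit_const uniform_limit_iff)

lemma calculus_value_add:
  assumes "is_calculus_value a f x" "is_calculus_value a g y"
  shows "is_calculus_value a (\<lambda>z. f z + g z) (x + y)"
proof -
  obtain p q where "uniform_limit (spectrum a) (\<lambda>n. poly (p n)) f sequentially"
    "(\<lambda>n. apply_poly a (p n)) \<longlonglongrightarrow> x" "uniform_limit (spectrum a) (\<lambda>n. poly (q n)) g sequentially"
    "(\<lambda>n. apply_poly a (q n)) \<longlonglongrightarrow> y"
    using assms unfolding is_calculus_value_def by blast
  then have "uniform_limit (spectrum a) (\<lambda>n. poly (p n + q n)) (\<lambda>z. f z + g z) sequentially"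
    "(\<lambda>n. apply_poly a (p n + q n)) \<longlonglongrightarrow> x + y"
    unfolding poly_add apply_poly_add by (auto intro: uniform_limit_add tendsto_add)
  then show ?thesis unfolding is_calculus_value_def by (intro exI[of _ "\<lambda>n. p n + q n"] conjI)
qed

lemma calculus_value_mult:
  assumes "is_calculus_value a f x" "is_calculus_value a g y"
    and "continuous_on (spectrum a) f" "continuous_on (spectrum a) g"
  shows "is_calculus_value a (\<lambda>z. f z * g z) (x * y)"
proof -
  obtain p q where pq: "uniform_limit (spectrum a) (\<lambda>n. poly (p n)) f sequentially"
    "(\<lambda>n. apply_poly a (p n)) \<longlonglongrightarrow> x" "uniform_limit (spectrum a) (\<lambda>n. poly (q n)) g sequentially"
    "(\<lambda>n. apply_poly a (q n)) \<longlonglongrightarrow> y"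
    using assms unfolding is_calculus_value_def by blast
  have "bounded (f ` spectrum a)" "bounded (g ` spectrum a)"
    using assms spectrum_compact compact_continuous_image compact_imp_bounded by blast+
  then have "uniform_limit (spectrum a) (\<lambda>n z. poly (p n) z * poly (q n) z) (\<lambda>z. f z * g z) sequentially"
    by (intro bounded_bilinear.bounded_uniform_limit[OF bounded_bilinear_mult] pq)
  then have "uniform_limit (spectrum a) (\<lambda>n. poly (p n * q n)) (\<lambda>z. f z * g z) sequentially"
    unfolding poly_mult .
  moreover have "(\<lambda>n. apply_poly a (p n * q n)) \<longlonglongrightarrow> x * y"
    unfolding apply_poly_mult by (intro tendsto_mult pq)
  ultimately show ?thesis unfolding is_calculus_value_def by (intro exI[of _ "\<lambda>n. p n * q n"] conjI)
qed

lemma calculus_value_cnj: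
  assumes a: "star a = a" and f: "is_calculus_value a f x"
  shows "is_calculus_value a (\<lambda>z. cnj (f z)) (star x)"
proof -
  obtain p where p: "uniform_limit (spectrum a) (\<lambda>n. poly (p n)) f sequentially"
    "(\<lambda>n. apply_poly a (p n)) \<longlonglongrightarrow> x"
    using f unfolding is_calculus_value_def by blast
  have "uniform_limit (spectrum a) (\<lambda>n z. cnj (poly (p n) z)) (\<lambda>z. cnj (f z)) sequentially"
    by (intro uniform_limit_intros p)
  then have 1: "uniform_limit (spectrum a) (\<lambda>n. poly (map_poly cnj (p n))) (\<lambda>z. cnj (f z)) sequentially"
    by (rule uniform_limit_cong'[THEN iffD1, rotated 2])
      (simp_all only: poly_map_cnj_real[OF selfadjoint_spectrum_real[OF a]])
  have "(\<lambda>n. norm (apply_poly a (p n) - x)) \<longlonglongrightarrow> 0"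
    using p(2) by (simp add: LIM_zero tendsto_norm_zero)
  then have "(\<lambda>n. norm (star (apply_poly a (p n)) - star x)) \<longlonglongrightarrow> 0"
    by (simp flip: star_diff)
  then have "(\<lambda>n. apply_poly a (map_poly cnj (p n))) \<longlonglongrightarrow> star x"
    unfolding apply_poly_star[OF a] by (simp add: LIM_zero_iff tendsto_norm_zero_iff)
  with 1 show ?thesis
    unfolding is_calculus_value_def by (intro exI[of _ "\<lambda>n. map_poly cnj (p n)"] conjI)
qed

text \<open>The isometry for polynomials passes to the limit on both sides.\<close>

lemma calculus_value_norm:
  fixes a :: "'a::cstar_algebra"
  assumes a: "star a = a" and y: "is_calculus_value a f y"
  shows "norm y = (SUP z\<in>spectrum a. cmod (f z))"
proof -
  obtain p where p: "uniform_limit (spectrum a) (\<lambda>n. poly (p n)) f sequentially"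
    "(\<lambda>n. apply_poly a (p n)) \<longlonglongrightarrow> y"
    using y unfolding is_calculus_value_def by blast
  have lim: "(\<lambda>n. norm (apply_poly a (p n))) \<longlonglongrightarrow> norm y" using p(2) by (rule tendsto_norm)
  have le: "cmod (f z) \<le> norm y" if z: "z \<in> spectrum a" for z
  proof (rule LIMSEQ_le)
    show "(\<lambda>n. cmod (poly (p n) z)) \<longlonglongrightarrow> cmod (f z)"
      by (intro tendsto_norm tendsto_uniform_limitI[OF p(1) z])
    show "\<exists>N. \<forall>n\<ge>N. cmod (poly (p n) z) \<le> norm (apply_poly a (p n))"
      using norm_poly_value_le[OF a z] by blast
  qed (rule lim)
  then have bdd: "bdd_above ((\<lambda>z. cmod (f z)) ` spectrum a)" by (auto simp: bdd_above_def)
  show ?thesis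
  proof (rule antisym)
    show "(SUP z\<in>spectrum a. cmod (f z)) \<le> norm y"
      using le selfadjoint_spectrum_nonempty[OF a] by (intro cSUP_least)
    show "norm y \<le> (SUP z\<in>spectrum a. cmod (f z))"
    proof (rule field_le_epsilon)
      fix e :: real assume "e > 0"
      with uniform_limitD[OF p(1)]
      have "\<forall>\<^sub>F n in sequentially. \<forall>z\<in>spectrum a. dist (poly (p n) z) (f z) < e" by blast
      then have "\<forall>\<^sub>F n in sequentially. norm (apply_poly a (p n)) \<le> (SUP z\<in>spectrum a. cmod (f z)) + e"
      proof eventually_elim
        case (elim n)
        obtain z where z: "z \<in> spectrum a" "cmod (poly (p n) z) = norm (apply_poly a (p n))"
          using norm_apply_poly_attained[OF a] by blast
        have "cmod (poly (p n) z) \<le> cmod (f z) + dist (poly (p n) z) (f z)"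
          using norm_triangle_ineq[of "f z" "poly (p n) z - f z"] by (simp add: dist_norm)
        moreover have "cmod (f z) \<le> (SUP z\<in>spectrum a. cmod (f z))" by (rule cSUP_upper[OF z(1) bdd])
        moreover have "dist (poly (p n) z) (f z) < e" using elim z(1) by blast
        ultimately show ?case using z(2) by linarith
      qed
      then show "norm y \<le> (SUP z\<in>spectrum a. cmod (f z)) + e"
        by (intro tendsto_upperbound[OF lim]) auto
    qed
  qed
qed

lemma calculus_value_scaleC:
  assumes "is_calculus_value a f x" "continuous_on (spectrum a) f"
  shows "is_calculus_value a (\<lambda>z. c * f z) (c *\<^sub>C x)"
proof -
  have "is_calculus_value a (\<lambda>z. poly [:c:] z * f z) (apply_poly a [:c:] * x)"
    using assms by (intro calculus_value_mult calculus_value_poly continuous_intros)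
  then show ?thesis by (simp add: mult_scaleC_left)
qed

text \<open>The difference of two values is a value of the zero function, so its norm is \<open>0\<close>.\<close>

lemma calculus_value_unique:
  fixes a :: "'a::cstar_algebra"
  assumes a: "star a = a" and f: "continuous_on (spectrum a) f"
    and x: "is_calculus_value a f x" and y: "is_calculus_value a f y"
  shows "x = y"
proof -
  have "is_calculus_value a (\<lambda>z. f z + (- 1) * f z) (x + (- 1) *\<^sub>C y)"
    by (intro calculus_value_add calculus_value_scaleC x y f)
  from calculus_value_norm[OF a this] have "norm (x - y) = (SUP z\<in>spectrum a. 0)"
    by (simp add: scaleC_minus_left)
  with selfadjoint_spectrum_nonempty[OF a] show ?thesis by simp
qed

lemma functional_calculus_exists:
  fixes a :: "'a::cstar_algebra"
  assumes a: "star a = a"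
  shows "\<exists>\<Phi>. is_functional_calculus a \<Phi>"
proof -
  define \<Phi> where "\<Phi> f = (SOME y. is_calculus_value a f y)" for f
  have \<Phi>:  "is_calculus_value a f (\<Phi> f)" if "continuous_on (spectrum a) f" for f
    unfolding \<Phi>_def using calculus_value_exists[OF a that] by (rule someI_ex)
  have eqI: "\<Phi> f = y" if "continuous_on (spectrum a) f" "is_calculus_value a f y" for f y
    using calculus_value_unique[OF a that(1) \<Phi>[OF that(1)] that(2)] .
  have "is_functional_calculus a \<Phi>"
    unfolding is_functional_calculus_def
  proof (intro conjI allI impI)
    fix f g :: "complex \<Rightarrow> complex"
    assume f: "continuous_on (spectrum a) f" and g: "continuous_on (spectrum a) g"
    show "\<Phi> (\<lambda>z. f z + g z) = \<Phi> f + \<Phi> g"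
      using f g by (intro eqI calculus_value_add \<Phi> continuous_intros)
    show "\<Phi> (\<lambda>z. f z * g z) = \<Phi> f * \<Phi> g"
      using f g by (intro eqI calculus_value_mult \<Phi> continuous_intros)
  next
    fix c and f :: "complex \<Rightarrow> complex" assume f: "continuous_on (spectrum a) f"
    show "\<Phi> (\<lambda>z. c * f z) = c *\<^sub>C \<Phi> f"
      using f by (intro eqI calculus_value_scaleC \<Phi> continuous_intros)
    show "\<Phi> (\<lambda>z. cnj (f z)) = star (\<Phi> f)"
      using f by (intro eqI calculus_value_cnj a \<Phi> continuous_intros)
    show "norm (\<Phi> f) = (SUP z\<in>spectrum a. cmod (f z))"
      by (intro calculus_value_norm a \<Phi> f)
  next
    show "\<Phi> (\<lambda>z. 1) = 1"
      using calculus_value_poly[of a 1] by (intro eqI continuous_intros) (simp add: poly_1[abs_def])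
    show "\<Phi> (\<lambda>z. z) = a"
      using calculus_value_poly[of a "[:0, 1:]"] by (intro eqI continuous_intros) (simp add: poly_pCons[abs_def])
  qed
  then show ?thesis by blast
qed

text \<open>The functional calculus is isometric and \<open>t \<mapsto> t powr s\<close> is increasing on the spectrum, which lies
  in \<open>[0, norm a]\<close>. Existence of a functional calculus is what gives \<open>cfc\<close>, a choice, its meaning.\<close>

lemma norm_cstar_powr_le:
  fixes a :: "'a::cstar_algebra"
  assumes a: "positive a" and s: "s > 0"
  shows "norm (cstar_powr a s) \<le> norm a powr s"
proof -
  have sa: "star a = a" and spec: "spectrum a \<subseteq> complex_of_real ` {0..}"
    using a by (auto simp: positive_def)
  have "is_functional_calculus a (cfc a)"
    unfolding cfc_def using functional_calculus_exists[OF sa] by (rule someI_ex)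
  moreover have "continuous_on (spectrum a) (\<lambda>z. complex_of_real (Re z powr s))"
    using spec s by (intro continuous_intros continuous_on_powr') auto
  ultimately have "norm (cstar_powr a s) = (SUP z\<in>spectrum a. cmod (complex_of_real (Re z powr s)))"
    unfolding is_functional_calculus_def cstar_powr_def by blast
  also have "\<dots> \<le> norm a powr s"
  proof (rule cSUP_least[OF selfadjoint_spectrum_nonempty[OF sa]])
    fix z assume z: "z \<in> spectrum a"
    with spec have "0 \<le> Re z" "Re z = cmod z" by auto
    then show "cmod (complex_of_real (Re z powr s)) \<le> norm a powr s"
      using spectrum_norm_bound[OF z] s by (simp add: powr_mono2)
  qed
  finally show ?thesis .
qed

section \<open>Monotonicity of the norm on positive elements\<close>

lemma positive_norm_in_spectrum:
  fixes a :: "'a::cstar_algebra"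
  assumes "positive a"
  shows "complex_of_real (norm a) \<in> spectrum a"
proof -
  obtain c where "c \<in> spectrum a" "cmod c = norm a"
    using selfadjoint_norm_in_spectrum assms by (auto simp: positive_def)
  moreover from this assms have "c = complex_of_real (cmod c)" by (auto simp: positive_def)
  ultimately show ?thesis by simp
qed

lemma spectrum_affine:
  fixes a :: "'a::cstar_algebra"
  assumes "spectrum a \<noteq> {}"
  shows "spectrum (u *\<^sub>C 1 + v *\<^sub>C a) = (\<lambda>z. u + v * z) ` spectrum a"
  using spectrum_apply_poly[OF assms, of "[:u, v:]"]
  by (simp add: mult_scaleC_right mult.commute[of v])

text \<open>The spectrum of \<open>norm c - c\<close> is contained in \<open>[0, norm c]\<close>.\<close>

lemma positive_norm_complement_le:
  fixes c :: "'a::cstar_algebra"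
  assumes c: "positive c"
  shows "norm (norm c *\<^sub>R 1 - c) \<le> norm c"
proof -
  let ?b = "complex_of_real (norm c) *\<^sub>C 1 + (- 1) *\<^sub>C c"
  have sa: "star c = c" using c by (simp add: positive_def)
  have b: "?b = norm c *\<^sub>R 1 - c" by (simp add: scaleC_of_real scaleC_minus_left)
  have "star ?b = ?b" using sa by (simp add: star_add star_scaleC)
  then obtain w where w: "w \<in> spectrum ?b" "cmod w = norm ?b"
    using selfadjoint_norm_in_spectrum by blast
  then obtain z :: complex where z: "z \<in> spectrum c" "w = norm c - z"
    using spectrum_affine[OF selfadjoint_spectrum_nonempty[OF sa]] by auto
  with c obtain t where t: "z = complex_of_real t" "0 \<le> t" by (auto simp: positive_def)
  with spectrum_norm_bound[OF z(1)] have "t \<le> norm c" by simp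
  have "cmod w = \<bar>norm c - t\<bar>" unfolding z t by (simp flip: of_real_diff)
  also have "\<dots> \<le> norm c" using t \<open>t \<le> norm c\<close> by simp
  finally show ?thesis using w(2) b by simp
qed

text \<open>Let \<open>c = b - a\<close> and \<open>t = norm c\<close>. Since \<open>norm a\<close> is a spectral value of \<open>a\<close>, the norm of
  \<open>t + a\<close> is at least \<open>t + norm a\<close>. On the other hand \<open>t + a = b + (t - c)\<close>, whose norm is at most
  \<open>norm b + t\<close>.\<close>

lemma norm_mono_positive:
  fixes a b :: "'a::cstar_algebra"
  assumes a: "positive a" and ab: "a \<preceq> b"
  shows "norm a \<le> norm b"
proof -
  define c where "c = b - a"
  have c: "positive c" using ab by (simp add: cstar_le_def c_def)
  have sa: "star a = a" using a by (simp add: positive_def)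
  let ?t = "complex_of_real (norm c)"
  have "?t + 1 * complex_of_real (norm a) \<in> spectrum (?t *\<^sub>C 1 + 1 *\<^sub>C a)"
    unfolding spectrum_affine[OF selfadjoint_spectrum_nonempty[OF sa]]
    using positive_norm_in_spectrum[OF a] by blast
  from spectrum_norm_bound[OF this] have "norm c + norm a \<le> norm (norm c *\<^sub>R 1 + a)"
    by (simp add: scaleC_of_real flip: of_real_add)
  also have "norm c *\<^sub>R 1 + a = b + (norm c *\<^sub>R 1 - c)" by (simp add: c_def)
  also have "norm \<dots> \<le> norm b + norm c"
    using norm_triangle_ineq positive_norm_complement_le[OF c] by (meson add_left_mono order_trans)
  finally show ?thesis by simp
qed

section \<open>Interpolative Kannan contractions\<close>

context cstar_metric_space
begin

lemma norm_dist_triangle: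
  assumes "x \<in> U" "y \<in> U" "u \<in> U"
  shows "norm (d x y) \<le> norm (d x u) + norm (d u y)"
  using norm_mono_positive[OF dist_positive dist_triangle] norm_triangle_ineq assms
  by (meson order_trans)

text \<open>The constant \<open>C\<close> is chosen so that the first step has length \<open>C (1 - k)\<close>. The \<open>n\<close>-th step then has length
  at most \<open>C k\<^sup>n - C k\<^sup>n\<^sup>+\<^sup>1\<close>, and the sum of the steps telescopes.\<close>

lemma geometric_steps_cauchy:
  assumes x: "\<And>n. x n \<in> U" and k: "0 \<le> k" "k < 1"
    and step: "\<And>n. norm (d (x (Suc n)) (x (Suc (Suc n)))) \<le> k * norm (d (x n) (x (Suc n)))"
  shows "cauchy_seq x"
proof -
  define C where "C = norm (d (x 0) (x (Suc 0))) / (1 - k)"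
  have C: "C \<ge> 0" "norm (d (x 0) (x (Suc 0))) = C * (1 - k)" using k by (simp_all add: C_def)
  have steps: "norm (d (x n) (x (Suc n))) \<le> C * (1 - k) * k ^ n" for n
  proof (induction n)
    case (Suc n)
    have "norm (d (x (Suc n)) (x (Suc (Suc n)))) \<le> k * (C * (1 - k) * k ^ n)"
      using step[of n] mult_left_mono[OF Suc k(1)] by linarith
    then show ?case by (simp add: ac_simps)
  qed (simp add: C)
  have tail: "norm (d (x n) (x (n + j))) \<le> C * k ^ n" for n j
  proof (induction j arbitrary: n)
    case 0
    have "d (x n) (x n) = 0" using dist_eq_0_iff x by blast
    then show ?case using C k by simp
  next
    case (Suc j)
    have "norm (d (x n) (x (n + Suc j)))
        \<le> norm (d (x n) (x (Suc n))) + norm (d (x (Suc n)) (x (Suc n + j)))"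
      using norm_dist_triangle[of "x n" "x (n + Suc j)" "x (Suc n)"] x by simp
    also have "\<dots> \<le> C * (1 - k) * k ^ n + C * k ^ Suc n" using steps Suc by (rule add_mono)
    also have "\<dots> = C * k ^ n" by (simp add: algebra_simps)
    finally show ?case .
  qed
  show ?thesis
    unfolding cauchy_seq_def
  proof (intro allI impI)
    fix e :: real assume "e > 0"
    have "(\<lambda>n. C * k ^ n) \<longlonglongrightarrow> 0"
      using k by (intro tendsto_mult_right_zero LIMSEQ_power_zero) simp
    then have "\<forall>\<^sub>F n in sequentially. C * k ^ n < e" using \<open>e > 0\<close> by (rule order_tendstoD)
    then obtain N where N: "\<And>n. n \<ge> N \<Longrightarrow> C * k ^ n < e" by (auto simp: eventually_sequentially)
    have "norm (d (x n) (x m)) < e" if "n \<ge> N" "m \<ge> N" for n m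
    proof (cases "n \<le> m")
      case True
      with tail[of n "m - n"] N[OF that(1)] show ?thesis by simp
    next
      case False
      with tail[of m "n - m"] N[OF that(2)] dist_sym[OF x x, of n m] show ?thesis by simp
    qed
    then show "\<exists>N. \<forall>n\<ge>N. \<forall>m\<ge>N. norm (d (x n) (x m)) < e" by blast
  qed
qed

text \<open>For two positive elements the product of powers is in general not positive, so the argument must not
  start from its positivity; monotonicity of the norm asks only that the left side is positive.\<close>

lemma kannan_norm_bound:
  assumes T: "T \<in> U \<rightarrow> U" and xy: "x \<in> U" "y \<in> U" and \<beta>: "0 < \<beta>" "\<beta> < 1" and \<tau>: "0 < \<tau>"
    and le: "d (T x) (T y) \<preceq> \<tau> *\<^sub>R (cstar_powr (d x (T x)) \<beta> * cstar_powr (d y (T y)) (1 - \<beta>))"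
  shows "norm (d (T x) (T y)) \<le> \<tau> * (norm (d x (T x)) powr \<beta> * norm (d y (T y)) powr (1 - \<beta>))"
proof -
  have mem: "T x \<in> U" "T y \<in> U" using T xy by auto
  let ?X = "cstar_powr (d x (T x)) \<beta>" and ?Y = "cstar_powr (d y (T y)) (1 - \<beta>)"
  have "norm (d (T x) (T y)) \<le> norm (\<tau> *\<^sub>R (?X * ?Y))"
    by (intro norm_mono_positive dist_positive mem le)
  also have "\<dots> \<le> \<tau> * (norm ?X * norm ?Y)"
    using \<tau> norm_mult_ineq[of ?X ?Y] by simp
  also have "\<dots> \<le> \<tau> * (norm (d x (T x)) powr \<beta> * norm (d y (T y)) powr (1 - \<beta>))"
    using \<tau> \<beta> by (intro mult_left_mono mult_mono norm_cstar_powr_le dist_positive xy mem) auto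
  finally show ?thesis .
qed

end

text \<open>Cancel \<open>s powr (1 - \<beta>)\<close> and take the root of order \<open>\<beta>\<close>: the implicit estimate, in which the
  new length \<open>s\<close> is also on the right, becomes a linear contraction.\<close>

lemma interpolative_step:
  fixes r s :: real
  assumes "0 < \<tau>" "0 < \<beta>" "0 < r" "0 < s" and le: "s \<le> \<tau> * (r powr \<beta> * s powr (1 - \<beta>))"
  shows "s \<le> \<tau> powr (1 / \<beta>) * r"
proof -
  have "s powr \<beta> * s powr (1 - \<beta>) = s" using assms by (simp flip: powr_add)
  with le have "s powr \<beta> * s powr (1 - \<beta>) \<le> \<tau> * r powr \<beta> * s powr (1 - \<beta>)"
    by (simp add: mult.assoc)
  then have "s powr \<beta> \<le> \<tau> * r powr \<beta>" using assms by simp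
  then have "(s powr \<beta>) powr (1 / \<beta>) \<le> (\<tau> * r powr \<beta>) powr (1 / \<beta>)"
    using assms by (intro powr_mono2) auto
  then show ?thesis using assms by (simp add: powr_powr powr_mult)
qed

theorem theorem2p2:
  fixes U :: "'u set" and d :: "'u \<Rightarrow> 'u \<Rightarrow> 'a::cstar_algebra" and T :: "'u \<Rightarrow> 'u"
  assumes "complete_cstar_metric_space U d"
    and "T \<in> U \<rightarrow> U"
    and "interpolative_kannan U d T"
  shows "\<exists>z\<in>U. T z = z"
proof (rule ccontr)
  assume no: "\<not> ?thesis"
  interpret complete_cstar_metric_space U d by fact
  obtain \<tau> \<beta> where \<tau>: "0 < \<tau>" "\<tau> < 1" and \<beta>: "0 < \<beta>" "\<beta> < 1"
    and contr: "\<And>x y. x \<in> U \<Longrightarrow> y \<in> U \<Longrightarrow> T x \<noteq> x \<Longrightarrow>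
      d (T x) (T y) \<preceq> \<tau> *\<^sub>R (cstar_powr (d x (T x)) \<beta> * cstar_powr (d y (T y)) (1 - \<beta>))"
    using assms(3) unfolding interpolative_kannan_def by auto
  have bound: "norm (d (T x) (T y)) \<le> \<tau> * (norm (d x (T x)) powr \<beta> * norm (d y (T y)) powr (1 - \<beta>))"
    if "x \<in> U" "y \<in> U" for x y
    using kannan_norm_bound[OF assms(2) that \<beta> \<tau>(1) contr[OF that]] no that by blast
  have TU: "T x \<in> U" if "x \<in> U" for x using assms(2) that by auto
  have pos: "0 < norm (d x (T x))" if "x \<in> U" for x
    using dist_eq_0_iff[OF that TU[OF that]] no that by auto
  define k where "k = \<tau> powr (1 / \<beta>)"
  have "k < 1 powr (1 / \<beta>)" unfolding k_def using \<tau> \<beta> by (intro powr_less_mono2) auto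
  then have k: "0 \<le> k" "k < 1" by (simp_all add: k_def)
  obtain x0 where x0: "x0 \<in> U" using nonempty by auto
  define x where "x n = (T ^^ n) x0" for n
  have xU: "x n \<in> U" for n by (induction n) (simp_all add: x_def x0 TU)
  have x_Suc: "x (Suc n) = T (x n)" for n by (simp add: x_def)
  have step: "norm (d (x (Suc n)) (x (Suc (Suc n)))) \<le> k * norm (d (x n) (x (Suc n)))" for n
    unfolding k_def x_Suc using \<tau> \<beta> pos xU TU bound by (intro interpolative_step) auto
  have "cauchy_seq x" using xU k step by (rule geometric_steps_cauchy)
  then obtain z where z: "z \<in> U" "converges_to x z" using complete xU by blast
  have lim: "(\<lambda>n. norm (d (x n) z)) \<longlonglongrightarrow> 0" using z(2) by (simp add: converges_to_def)
  have steps_le: "norm (d (x n) (x (Suc n))) \<le> norm (d (x n) z) + norm (d (x (Suc n)) z)" for n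
    using norm_dist_triangle[OF xU xU z(1), of n "Suc n"] dist_sym[OF z(1) xU, of "Suc n"] by simp
  have "(\<lambda>n. norm (d (x n) z) + norm (d (x (Suc n)) z)) \<longlonglongrightarrow> 0"
    using tendsto_add[OF lim LIMSEQ_Suc[OF lim]] by simp
  then have steps0: "(\<lambda>n. norm (d (x n) (x (Suc n)))) \<longlonglongrightarrow> 0"
    by (rule tendsto_sandwich[rotated 2, OF tendsto_const])
      (use steps_le in auto)
  let ?D = "norm (d z (T z))"
  \<comment> \<open>the contraction condition for the pair \<open>x n\<close>, \<open>z\<close>; its right side vanishes in the limit\<close>
  have "?D \<le> norm (d (x (Suc n)) z) + \<tau> * (norm (d (x n) (x (Suc n))) powr \<beta> * ?D powr (1 - \<beta>))" for n
    using norm_dist_triangle[OF z(1) TU[OF z(1)] xU[of "Suc n"]] dist_sym[OF z(1) xU, of "Suc n"]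
      bound[OF xU[of n] z(1)] by (simp add: x_Suc)
  moreover have "(\<lambda>n. norm (d (x (Suc n)) z) + \<tau> * (norm (d (x n) (x (Suc n))) powr \<beta> * ?D powr (1 - \<beta>)))
      \<longlonglongrightarrow> 0 + \<tau> * (0 powr \<beta> * ?D powr (1 - \<beta>))"
    using \<beta> by (intro tendsto_intros LIMSEQ_Suc[OF lim] tendsto_powr'[OF steps0]) auto
  ultimately have "?D \<le> 0 + \<tau> * (0 powr \<beta> * ?D powr (1 - \<beta>))"
    by (intro LIMSEQ_le_const) auto
  with pos[OF z(1)] show False by simp
qed

end
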